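(* Let $\lambda>-\tfrac12$, $\lambda\ne0$, and let $G_p^{(\lambda)}(x)$ denote the Gegenbauer polynomial of degree $p$. Then for every integer $p\ge2$ and every real $x$, $$\begin{aligned}G_{p+2}^{(\lambda)}(x)={}&K(p,\lambda)\Big(4(p+\lambda-1)(p+\lambda)(p+\lambda+1)x^2-p(p+\lambda+1)(p+2\lambda-1)\\&\qquad-(p+1)(p+\lambda-1)(p+2\lambda)\Big)G_p^{(\lambda)}(x)\\&-K(p,\lambda)(p+\lambda+1)(p+2\lambda-1)(p+2\lambda-2)\,G_{p-2}^{(\lambda)}(x),\end{aligned}$$ where $K(p,\lambda)=\dfrac{1}{(p+1)(p+2)(p+\lambda-1)}$, with initial values $G_0^{(\lambda)}(x)=1$, $G_1^{(\lambda)}(x)=2\lambda x$, $G_2^{(\lambda)}(x)=2\lambda(\lambda+1)x^2-\lambda$ and $G_3^{(\lambda)}(x)=\frac43\lambda(\lambda+1)(\lambda+2)x^3-2\lambda(\lambda+1)x$.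
   Context: The Gegenbauer polynomials are $G_p^{(\lambda)}(x)=\frac{1}{\Gamma(\lambda)}\sum_{q=0}^{\lfloor p/2\rfloor}(-1)^q\frac{\Gamma(p-q+\lambda)}{q!\,(p-2q)!}(2x)^{p-2q}$. Equivalently, $G_0^{(\lambda)}(x)=1$, $G_1^{(\lambda)}(x)=2\lambda x$ and $G_{p+1}^{(\lambda)}(x)=\frac{2(p+\lambda)}{p+1}xG_p^{(\lambda)}(x)-\frac{p+2\lambda-1}{p+1}G_{p-1}^{(\lambda)}(x)$ for $p\ge1$. *)

theory Defs
  imports "HOL-Analysis.Gamma_Function"
begin

(* The explicit sum is a genuine closed form for every real parameter l that is not a
   non-positive integer; at the poles of Gamma the library value Gamma l = 0 makes it
   degenerate. In the sum q <= p div 2, so the truncated subtractions are exact. *)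
definition gegenbauer :: "real \<Rightarrow> nat \<Rightarrow> real \<Rightarrow> real" where
  "gegenbauer l p x =
     1 / Gamma l *
     (\<Sum>q = 0..p div 2.
        (-1) ^ q * (Gamma (real (p - q) + l) / (fact q * fact (p - 2 * q))) * (2 * x) ^ (p - 2 * q))"

definition gegenbauer_K :: "nat \<Rightarrow> real \<Rightarrow> real" where
  "gegenbauer_K p l = 1 / ((real p + 1) * (real p + 2) * (real p + l - 1))"

end

theory Submission
  imports Defs
begin

text \<open>
  The step-two recurrence follows from the classical three-term recurrence
  \<open>(n + 2) G (n + 2) = 2 (n + 1 + l) x G (n + 1) - (n + 2 l) G n\<close>
  by elimination. Its instances at \<open>n = p\<close> and \<open>n = p - 1\<close> express \<open>G (p + 2)\<close> through \<open>G p\<close> and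
  \<open>x G (p - 1)\<close>; the instance at \<open>n = p - 2\<close> expresses \<open>x G (p - 1)\<close> through \<open>G p\<close> and
  \<open>G (p - 2)\<close>, at the price of dividing by \<open>p + l - 1\<close>, which is positive for \<open>p \<ge> 2\<close>.

  The three-term recurrence in turn holds summand by summand in the explicit formula, once the
  summation index of \<open>G n\<close> is shifted by one against the other two
  (\<open>gegenbauer_term_rec\<close>). To make this a rational identity,
  \<open>Gamma (k + l) / Gamma l\<close> is rewritten as the rising factorial \<open>pochhammer l k\<close>; this is
  where \<open>l\<close> must avoid the poles of \<open>Gamma\<close>.
\<close>

text \<open>
  Extending the summands by zero allows sums for different degrees to be taken over a common
  range of indices.
\<close>
definition gegenbauer_term :: "real \<Rightarrow> real \<Rightarrow> nat \<Rightarrow> nat \<Rightarrow> real" where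
  "gegenbauer_term l x p q =
     (if 2 * q \<le> p
      then (-1) ^ q * pochhammer l (p - q) / (fact q * fact (p - 2 * q)) * (2 * x) ^ (p - 2 * q)
      else 0)"

lemma gegenbauer_eq_sum_terms:
  assumes l: "l \<notin> \<int>\<^sub>\<le>\<^sub>0" and N: "p div 2 \<le> N"
  shows "gegenbauer l p x = (\<Sum>q\<le>N. gegenbauer_term l x p q)"
proof -
  have poch: "pochhammer l k = Gamma (real k + l) / Gamma l" for k
    using pochhammer_Gamma[OF l, of k] by (simp add: add.commute)
  have "gegenbauer l p x = (\<Sum>q = 0..p div 2. gegenbauer_term l x p q)"
    unfolding gegenbauer_def sum_distrib_left
    by (intro sum.cong refl) (auto simp: gegenbauer_term_def poch)
  also have "\<dots> = (\<Sum>q\<le>N. gegenbauer_term l x p q)"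
    using N by (intro sum.mono_neutral_left) (auto simp: gegenbauer_term_def)
  finally show ?thesis .
qed

lemma gegenbauer_term_rec_0:
  "(real n + 2) * gegenbauer_term l x (n + 2) 0 =
     2 * (real n + 1 + l) * x * gegenbauer_term l x (n + 1) 0"
  by (simp add: gegenbauer_term_def pochhammer_Suc divide_simps) (simp add: algebra_simps)

text \<open>
  All three monomials have the same exponent \<open>n - 2 q\<close>. For \<open>n = 2 q + m + 1\<close>, cancelling the
  common factor of the coefficients leaves
  \<open>(n + 2) (l + q + m + 1) = (n + 1 + l) (m + 1) + (n + 2 l) (q + 1)\<close>.
  For \<open>n = 2 q\<close> the middle term is absent.
\<close>
lemma gegenbauer_term_rec:
  "(real n + 2) * gegenbauer_term l x (n + 2) (Suc q) =
     2 * (real n + 1 + l) * x * gegenbauer_term l x (n + 1) (Suc q)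
     - (real n + 2 * l) * gegenbauer_term l x n q"
proof -
  consider "n < 2 * q" | "n = 2 * q" | m where "n = 2 * q + m + 1"
    by (metis add.commute less_imp_add_positive linorder_neqE_nat add_Suc_right
        Suc_eq_plus1 gr0_implies_Suc)
  then show ?thesis
  proof cases
    case 1
    then show ?thesis by (simp add: gegenbauer_term_def)
  next
    case 2
    then show ?thesis
      by (simp add: gegenbauer_term_def pochhammer_Suc divide_simps) (simp add: algebra_simps)
  next
    case (3 m)
    define c where "c = (-1) ^ q * pochhammer l (q + m + 1) / (fact (Suc q) * fact (Suc m))
                          * (2 * x) ^ (m + 1)"
    have a: "gegenbauer_term l x (n + 2) (Suc q) = - ((l + real q + real m + 1) * c)"
    proof -
      have "n + 2 - Suc q = Suc (q + m + 1)" "n + 2 - 2 * Suc q = Suc m" "2 * Suc q \<le> n + 2"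
        using 3 by auto
      moreover have "pochhammer l (Suc (q + m + 1)) =
                       (l + real q + real m + 1) * pochhammer l (q + m + 1)"
        by (simp only: pochhammer_rec' of_nat_add of_nat_1 add.assoc)
      ultimately show ?thesis
        unfolding gegenbauer_term_def c_def by (simp add: mult_ac)
    qed
    have b: "2 * x * gegenbauer_term l x (n + 1) (Suc q) = - ((real m + 1) * c)"
    proof -
      have "n + 1 - Suc q = q + m + 1" "n + 1 - 2 * Suc q = m" "2 * Suc q \<le> n + 1"
        using 3 by auto
      then show ?thesis
        unfolding gegenbauer_term_def c_def by (simp add: mult_ac add_ac)
    qed
    have d: "gegenbauer_term l x n q = (real q + 1) * c"
    proof -
      have "n - q = q + m + 1" "n - 2 * q = Suc m" "2 * q \<le> n"
        using 3 by auto
      then show ?thesis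
        unfolding gegenbauer_term_def c_def by (simp add: mult_ac add_ac)
    qed
    have "2 * (real n + 1 + l) * x * gegenbauer_term l x (n + 1) (Suc q) =
            (real n + 1 + l) * (- ((real m + 1) * c))"
      unfolding b[symmetric] by (simp only: mult_ac)
    then show ?thesis
      unfolding a d using 3 by (simp add: algebra_simps)
  qed
qed

lemma gegenbauer_three_term:
  assumes l: "l \<notin> \<int>\<^sub>\<le>\<^sub>0"
  shows "(real n + 2) * gegenbauer l (n + 2) x =
           2 * (real n + 1 + l) * x * gegenbauer l (n + 1) x - (real n + 2 * l) * gegenbauer l n x"
proof -
  let ?t = "gegenbauer_term l x"
  have eq: "gegenbauer l p x = ?t p 0 + (\<Sum>q\<le>n. ?t p (Suc q))" if "p \<le> n + 2" for p
    using gegenbauer_eq_sum_terms[OF l, of p "Suc n" x] that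
    by (simp add: sum.atMost_Suc_shift del: sum.atMost_Suc)
  have "(real n + 2) * gegenbauer l (n + 2) x =
          (real n + 2) * ?t (n + 2) 0 + (\<Sum>q\<le>n. (real n + 2) * ?t (n + 2) (Suc q))"
    by (simp add: eq distrib_left sum_distrib_left)
  also have "\<dots> = 2 * (real n + 1 + l) * x * (?t (n + 1) 0 + (\<Sum>q\<le>n. ?t (n + 1) (Suc q)))
                    - (real n + 2 * l) * (\<Sum>q\<le>n. ?t n q)"
    by (simp only: gegenbauer_term_rec_0 gegenbauer_term_rec sum_subtractf
        sum_distrib_left[symmetric] distrib_left add_diff_eq)
  also have "\<dots> = 2 * (real n + 1 + l) * x * gegenbauer l (n + 1) x
                    - (real n + 2 * l) * gegenbauer l n x"
    using gegenbauer_eq_sum_terms[OF l, of n n x] by (simp add: eq)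
  finally show ?thesis .
qed

lemma gegenbauer_0: "l \<notin> \<int>\<^sub>\<le>\<^sub>0 \<Longrightarrow> gegenbauer l 0 x = 1"
  using gegenbauer_eq_sum_terms[of l 0 0 x] by (simp add: gegenbauer_term_def)

lemma gegenbauer_1: "l \<notin> \<int>\<^sub>\<le>\<^sub>0 \<Longrightarrow> gegenbauer l 1 x = 2 * l * x"
  using gegenbauer_eq_sum_terms[of l 1 0 x] by (simp add: gegenbauer_term_def)

lemma gegenbauer_2:
  assumes "l \<notin> \<int>\<^sub>\<le>\<^sub>0"
  shows "gegenbauer l 2 x = 2 * l * (l + 1) * x\<^sup>2 - l"
  using gegenbauer_three_term[OF assms, of 0 x] gegenbauer_0[OF assms] gegenbauer_1[OF assms]
  by (simp add: numeral_2_eq_2[symmetric] power2_eq_square algebra_simps)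

lemma gegenbauer_3:
  assumes "l \<notin> \<int>\<^sub>\<le>\<^sub>0"
  shows "gegenbauer l 3 x = 4 / 3 * l * (l + 1) * (l + 2) * x ^ 3 - 2 * l * (l + 1) * x"
proof -
  have "3 * gegenbauer l 3 x = 2 * (2 + l) * x * gegenbauer l 2 x - (1 + 2 * l) * gegenbauer l 1 x"
    using gegenbauer_three_term[OF assms, of 1 x] by (simp add: eval_nat_numeral)
  then show ?thesis
    unfolding gegenbauer_1[OF assms] gegenbauer_2[OF assms]
    by (simp add: power2_eq_square power3_eq_cube field_simps)
qed

text \<open>
  The elimination behind the step-two recurrence, with the three instances of the three-term
  recurrence as hypotheses and \<open>d\<close> standing for the degree \<open>p\<close>.
\<close>
lemma three_term_elimination:
  fixes d l x g0 g1 g2 g3 g4 :: real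
  assumes g4: "(d + 2) * g4 = 2 * (d + 1 + l) * x * g3 - (d + 2 * l) * g2"
    and g3: "(d + 1) * g3 = 2 * (d + l) * x * g2 - (d - 1 + 2 * l) * g1"
    and g2: "d * g2 = 2 * (d - 1 + l) * x * g1 - (d - 2 + 2 * l) * g0"
  shows "(d + 1) * (d + 2) * (d + l - 1) * g4 =
           (4 * (d + l - 1) * (d + l) * (d + l + 1) * x\<^sup>2
              - d * (d + l + 1) * (d + 2 * l - 1)
              - (d + 1) * (d + l - 1) * (d + 2 * l)) * g2
           - (d + l + 1) * (d + 2 * l - 1) * (d + 2 * l - 2) * g0"
proof -
  have "(d + 1) * (d + 2) * (d + l - 1) * g4 = (d + 1) * (d + l - 1) * ((d + 2) * g4)"
    by (simp only: mult_ac)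
  also have "\<dots> = 2 * (d + 1 + l) * (d + l - 1) * x * ((d + 1) * g3)
                    - (d + 1) * (d + l - 1) * (d + 2 * l) * g2"
    unfolding g4 by algebra
  also have "\<dots> = (4 * (d + l - 1) * (d + l) * (d + l + 1) * x\<^sup>2
                      - (d + 1) * (d + l - 1) * (d + 2 * l)) * g2
                    - (d + l + 1) * (d + 2 * l - 1) * (2 * (d - 1 + l) * x * g1)"
    unfolding g3 by algebra
  also have "2 * (d - 1 + l) * x * g1 = d * g2 + (d + 2 * l - 2) * g0"
    using g2 by algebra
  finally show ?thesis by algebra
qed

theorem mainTheorem6:
  fixes l :: real
  assumes "l > - 1 / 2" and "l \<noteq> 0"
  shows "(\<forall>(p::nat) (x::real). p \<ge> 2 \<longrightarrow>
            gegenbauer l (p + 2) x =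
              gegenbauer_K p l *
                (4 * (real p + l - 1) * (real p + l) * (real p + l + 1) * x\<^sup>2
                 - real p * (real p + l + 1) * (real p + 2 * l - 1)
                 - (real p + 1) * (real p + l - 1) * (real p + 2 * l)) * gegenbauer l p x
              - gegenbauer_K p l * (real p + l + 1) * (real p + 2 * l - 1) * (real p + 2 * l - 2)
                * gegenbauer l (p - 2) x) \<and>
         (\<forall>x::real.
            gegenbauer l 0 x = 1 \<and>
            gegenbauer l 1 x = 2 * l * x \<and>
            gegenbauer l 2 x = 2 * l * (l + 1) * x\<^sup>2 - l \<and>
            gegenbauer l 3 x = 4 / 3 * l * (l + 1) * (l + 2) * x ^ 3 - 2 * l * (l + 1) * x)"
proof -
  have l: "l \<notin> \<int>\<^sub>\<le>\<^sub>0"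
  proof
    assume "l \<in> \<int>\<^sub>\<le>\<^sub>0"
    then obtain k where "l = - real k"
      by (auto elim: nonpos_Ints_cases')
    with assms show False by (cases k) auto
  qed
  have "gegenbauer l (p + 2) x =
          gegenbauer_K p l *
            (4 * (real p + l - 1) * (real p + l) * (real p + l + 1) * x\<^sup>2
             - real p * (real p + l + 1) * (real p + 2 * l - 1)
             - (real p + 1) * (real p + l - 1) * (real p + 2 * l)) * gegenbauer l p x
          - gegenbauer_K p l * (real p + l + 1) * (real p + 2 * l - 1) * (real p + 2 * l - 2)
            * gegenbauer l (p - 2) x"
    (is "?g4 = ?K * ?A * ?g2 - ?K * ?a * ?b * ?c * ?g0")
    if p: "p \<ge> 2" for p :: nat and x :: real
  proof -
    obtain n where n: "p = n + 2"
      using p by (metis le_add_diff_inverse2)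
    let ?D = "(real p + 1) * (real p + 2) * (real p + l - 1)"
    have elim: "?D * ?g4 =
            ?A * ?g2 - ?a * ?b * ?c * ?g0"
    proof (rule three_term_elimination)
      show "(real p + 2) * ?g4 = 2 * (real p + 1 + l) * x * gegenbauer l (p + 1) x
              - (real p + 2 * l) * ?g2"
        by (rule gegenbauer_three_term[OF l])
      show "(real p + 1) * gegenbauer l (p + 1) x =
              2 * (real p + l) * x * ?g2 - (real p - 1 + 2 * l) * gegenbauer l (n + 1) x"
        using gegenbauer_three_term[OF l, of "n + 1" x] n by (simp add: add_ac)
      show "real p * ?g2 = 2 * (real p - 1 + l) * x * gegenbauer l (n + 1) x
              - (real p - 2 + 2 * l) * ?g0"
        using gegenbauer_three_term[OF l, of n x] n by (simp add: add_ac)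
    qed
    have "?D \<noteq> 0"
      using p assms(1) by auto
    then have "?K * ?D = 1"
      unfolding gegenbauer_K_def by simp
    then have "?g4 = ?K * (?D * ?g4)"
      by (simp only: mult.assoc[symmetric, of ?K ?D] mult_1)
    then have "?g4 = ?K * (?A * ?g2 - ?a * ?b * ?c * ?g0)"
      unfolding elim .
    then show ?thesis
      unfolding right_diff_distrib[of ?K "?A * ?g2"] by (simp only: mult.assoc)
  qed
  then show ?thesis
    using gegenbauer_0[OF l] gegenbauer_1[OF l] gegenbauer_2[OF l] gegenbauer_3[OF l] by blast
qed

end
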